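(* Let $F$ be a distribution function on $\mathbb{R}^+$ with $\inf \operatorname{supp} F = 1$ and $F(1) = p > p^{\rightarrow}_{c}$, and let the passage times $\{t(e) : e \in \mathcal{E}^2\}$ be i.i.d. with distribution function $F$. Then almost surely there exists a bi-infinite geodesic.
   Context: First passage percolation on the lattice $(\mathbb{Z}^2,\mathcal{E}^2)$: two vertices $\mathbf{x},\mathbf{y}\in\mathbb{Z}^2$ are neighbours if $\|\mathbf{x}-\mathbf{y}\|_1=1$, and $\mathcal{E}^2$ is the set of line segments (edges) between neighbouring vertices. Each edge $e$ carries a strictly positive random passage time $t(e)$. A lattice path is a sequence of successively neighbouring vertices $\{\gamma(i): i\in I\}$, $I\subseteq\mathbb{Z}$; it is bi-infinite if $I=\mathbb{Z}$. For a finite path $\gamma$, $\tau(\gamma)$ is the sum of $t(e)$ over the edges along $\gamma$; $\tau(\mathbf{x},\mathbf{y})=\inf_{\gamma}\tau(\gamma)$ over finite paths from $\mathbf{x}$ to $\mathbf{y}$. A geodesic from $\mathbf{x}$ to $\mathbf{y}$ is a finite path $\gamma$ from $\mathbf{x}$ to $\mathbf{y}$ with $\tau(\gamma)=\tau(\mathbf{x},\mathbf{y})$. A bi-infinite geodesic is a bi-infinite path each of whose finite subpaths is a geodesic. $p^{\rightarrow}_c$ is the critical value of oriented bond percolation on $\mathbb{Z}^2$, in which each vertex $\mathbf{x}$ has two oriented edges, to $\mathbf{x}+(1,0)$ and $\mathbf{x}+(0,1)$, each open independently with probability $p$: the probability that there is an infinite oriented open path from the origin is $0$ for $p\le p^{\rightarrow}_c$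 and positive for $p>p^{\rightarrow}_c$. *)

theory Defs
  imports "HOL-Probability.Probability"
begin

section \<open>The square lattice\<close>

type_synonym vertex = "int \<times> int"

definition neighbour :: "vertex \<Rightarrow> vertex \<Rightarrow> bool" where
  "neighbour x y \<longleftrightarrow> \<bar>fst x - fst y\<bar> + \<bar>snd x - snd y\<bar> = 1"

text \<open>An (unoriented) edge is represented by the set of its two end points.\<close>

definition lattice_edges :: "vertex set set" where
  "lattice_edges = {{x, y} | x y. neighbour x y}"

text \<open>
  A path is given by an interval \<open>I\<close> of integers and a function on the integers, of which only the
  values on \<open>I\<close> matter. Vertices and edges may be repeated.
\<close>

definition lattice_path :: "int set \<Rightarrow> (int \<Rightarrow> vertex) \<Rightarrow> bool" where
  "lattice_path I \<gamma> \<longleftrightarrow> (\<forall>i. i \<in> I \<and> i + 1 \<in> I \<longrightarrow> neighbour (\<gamma> i) (\<gamma> (i + 1)))"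

definition finite_path_between ::
    "vertex \<Rightarrow> vertex \<Rightarrow> int \<Rightarrow> int \<Rightarrow> (int \<Rightarrow> vertex) \<Rightarrow> bool" where
  "finite_path_between x y m n \<gamma> \<longleftrightarrow>
     m \<le> n \<and> lattice_path {m..n} \<gamma> \<and> \<gamma> m = x \<and> \<gamma> n = y"


section \<open>Passage times and geodesics\<close>

definition path_time :: "(vertex set \<Rightarrow> real) \<Rightarrow> int \<Rightarrow> int \<Rightarrow> (int \<Rightarrow> vertex) \<Rightarrow> real" where
  "path_time t m n \<gamma> = (\<Sum>i\<in>{m..<n}. t {\<gamma> i, \<gamma> (i + 1)})"

text \<open>
  For positive edge times the infimum is over a nonempty set bounded below by 0, so that the
  infimum in \<^typ>\<open>real\<close> is the genuine one.
\<close>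

definition first_passage_time :: "(vertex set \<Rightarrow> real) \<Rightarrow> vertex \<Rightarrow> vertex \<Rightarrow> real" where
  "first_passage_time t x y = Inf {path_time t m n \<gamma> | m n \<gamma>. finite_path_between x y m n \<gamma>}"

definition geodesic ::
    "(vertex set \<Rightarrow> real) \<Rightarrow> vertex \<Rightarrow> vertex \<Rightarrow> int \<Rightarrow> int \<Rightarrow> (int \<Rightarrow> vertex) \<Rightarrow> bool" where
  "geodesic t x y m n \<gamma> \<longleftrightarrow>
     finite_path_between x y m n \<gamma> \<and> path_time t m n \<gamma> = first_passage_time t x y"

definition bi_infinite_geodesic :: "(vertex set \<Rightarrow> real) \<Rightarrow> (int \<Rightarrow> vertex) \<Rightarrow> bool" where
  "bi_infinite_geodesic t \<gamma> \<longleftrightarrow>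
     lattice_path UNIV \<gamma> \<and> (\<forall>m n. m \<le> n \<longrightarrow> geodesic t (\<gamma> m) (\<gamma> n) m n \<gamma>)"


section \<open>Distribution functions\<close>

text \<open>
  A distribution function on the nonnegative half-line, extended by 0 to the negative reals.
\<close>

definition distribution_function_on_nonneg :: "(real \<Rightarrow> real) \<Rightarrow> bool" where
  "distribution_function_on_nonneg F \<longleftrightarrow>
     mono F \<and> (\<forall>x. continuous (at_right x) F) \<and> (\<forall>x<0. F x = 0) \<and> (F \<longlongrightarrow> 1) at_top"

text \<open>
  The points all of whose neighbourhoods have positive mass;
  \<open>F (x + \<epsilon>) - F (x - \<epsilon>)\<close> is the mass of the interval \<open>{x - \<epsilon><..x + \<epsilon>}\<close>.
\<close>

definition cdf_support :: "(real \<Rightarrow> real) \<Rightarrow> real set" where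
  "cdf_support F = {x. \<forall>\<epsilon>>0. F (x + \<epsilon>) - F (x - \<epsilon>) > 0}"


section \<open>Oriented bond percolation\<close>

definition oriented_edges :: "(vertex \<times> vertex) set" where
  "oriented_edges = {(x, y). y = x + (1, 0) \<or> y = x + (0, 1)}"

definition oriented_percolation :: "real \<Rightarrow> (vertex \<times> vertex \<Rightarrow> bool) measure" where
  "oriented_percolation p = PiM oriented_edges (\<lambda>_. measure_pmf (bernoulli_pmf p))"

definition infinite_open_path_from_origin :: "(vertex \<times> vertex \<Rightarrow> bool) \<Rightarrow> bool" where
  "infinite_open_path_from_origin \<omega> \<longleftrightarrow>
     (\<exists>\<gamma>::nat \<Rightarrow> vertex. \<gamma> 0 = (0, 0) \<and>
        (\<forall>n. (\<gamma> n, \<gamma> (Suc n)) \<in> oriented_edges \<and> \<omega> (\<gamma> n, \<gamma> (Suc n))))"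

definition percolation_probability :: "real \<Rightarrow> real" where
  "percolation_probability p =
     measure (oriented_percolation p)
       {\<omega> \<in> space (oriented_percolation p). infinite_open_path_from_origin \<omega>}"

text \<open>
  The percolation probability is nondecreasing on \<open>{0..1}\<close> and vanishes at 0, so this is the
  threshold separating zero from positive percolation probability.
\<close>

definition oriented_critical_value :: real where
  "oriented_critical_value = Sup {p \<in> {0..1}. percolation_probability p = 0}"

end

theory Submission
  imports Defs
begin

text \<open>
  Call an edge \<^emph>\<open>open\<close> if its passage time is at most 1. Almost surely no passage time is below
  1 (\<open>cdf_zero_below_Inf_support\<close>, \<open>AE_ge_if_cdf_zero_below\<close>), so that every path takes at least as
  long as the \<open>\<ell>\<^sup>1\<close>-distance of its end points. A path of open edges all of whose steps go up or to
  the right attains this bound on each of its segments. Hence a bi-infinite up-right path of open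
  edges is a bi-infinite geodesic (\<open>oriented_path_is_geodesic\<close>), and it suffices to show that such
  a path exists almost surely.

  The edges are open independently with probability \<open>p\<close>, so that the edges of the upper right
  quadrant at a vertex \<open>x\<close> form oriented percolation with parameter \<open>p\<close>, and so do, after a point
  reflection, those of the lower left quadrant. The two quadrants share no edge. The event that
  there is an open bi-infinite up-right path through \<open>x\<close> therefore has probability \<open>\<theta>\<^sup>2\<close>, where
  \<open>\<theta> > 0\<close> is the percolation probability (\<open>prob_two_sided_forever\<close>).

  Positive probability is raised to probability 1 by a mixing argument (\<open>AE_two_sided_forever\<close>).
  The event \<open>E\<close> that some vertex lies on such a path is, up to small probability, determined by the
  edges of a finite box. It is thus almost independent of the event that a vertex \<open>y\<close> far away lies
  on such a path, which has probability \<open>\<theta>\<^sup>2\<close> wherever \<open>y\<close> is. But the latter event is contained in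
  \<open>E\<close>, so the complement \<open>H\<close> of \<open>E\<close> satisfies \<open>P(H) \<theta>\<^sup>2 = 0\<close>.

  All these events are handled through finite paths: by compactness there is an infinite path from
  a vertex iff there are paths of all lengths (\<open>infinite_open_path_iff_reaches\<close>). This gives
  measurability, dependence on finitely many edges, and approximation by decreasing events at once.
\<close>


section \<open>Oriented open paths\<close>

text \<open>
  There is an open oriented path with \<open>n\<close> edges that starts at \<open>v\<close>. The recursion makes
  measurability and locality straightforward inductions.
\<close>

primrec reaches :: "(vertex \<times> vertex \<Rightarrow> bool) \<Rightarrow> nat \<Rightarrow> vertex \<Rightarrow> bool" where
  "reaches \<eta> 0 v \<longleftrightarrow> True"
| "reaches \<eta> (Suc n) v \<longleftrightarrow> (\<exists>d\<in>{(1, 0), (0, 1)}. \<eta> (v, v + d) \<and> reaches \<eta> n (v + d))"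

lemma reaches_antimono:
  assumes "m \<le> n" "reaches \<eta> n v"
  shows "reaches \<eta> m v"
proof -
  have step: "reaches \<eta> n v" if "reaches \<eta> (Suc n) v" for n v
    using that
  proof (induction n arbitrary: v)
    case (Suc n)
    then show ?case
      by (subst reaches.simps, subst (asm) reaches.simps) blast
  qed simp
  from assms show ?thesis
    by (induction rule: inc_induct) (use step in blast)+
qed

text \<open>
  The pigeonhole step of Koenig's lemma: if each of the two successors failed at some length, then
  \<open>v\<close> would fail at one more than the larger of these lengths.
\<close>

lemma reaches_forever_step:
  assumes "\<And>n. reaches \<eta> n v"
  obtains d where "d \<in> {(1, 0), (0, 1)}" "\<eta> (v, v + d)" "\<And>n. reaches \<eta> n (v + d)"
proof -
  have "\<exists>d\<in>{(1, 0), (0, 1)}. \<eta> (v, v + d) \<and> (\<forall>n. reaches \<eta> n (v + d))"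
  proof (rule ccontr)
    assume no: "\<not> ?thesis"
    have "\<exists>n. \<not> (\<eta> (v, v + d) \<and> reaches \<eta> n (v + d))" if "d \<in> {(1, 0), (0, 1)}" for d
      using no that by blast
    then obtain a b where
      a: "\<not> (\<eta> (v, v + (1, 0)) \<and> reaches \<eta> a (v + (1, 0)))" and
      b: "\<not> (\<eta> (v, v + (0, 1)) \<and> reaches \<eta> b (v + (0, 1)))"
      by (metis insertI1 insertI2)
    have "reaches \<eta> (Suc (max a b)) v" by (rule assms)
    then consider "\<eta> (v, v + (1, 0))" "reaches \<eta> (max a b) (v + (1, 0))"
      | "\<eta> (v, v + (0, 1))" "reaches \<eta> (max a b) (v + (0, 1))"
      by auto
    then show False
    proof cases
      case 1
      with a show False using reaches_antimono[of a "max a b"] by simp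
    next
      case 2
      with b show False using reaches_antimono[of b "max a b"] by simp
    qed
  qed
  then show thesis using that by blast
qed

lemma oriented_edges_iff: "(u, w) \<in> oriented_edges \<longleftrightarrow> (\<exists>d\<in>{(1, 0), (0, 1)}. w = u + d)"
  by (auto simp: oriented_edges_def)

lemma reaches_if_path:
  assumes "\<And>k. (\<gamma> k, \<gamma> (Suc k)) \<in> oriented_edges \<and> \<eta> (\<gamma> k, \<gamma> (Suc k))"
  shows "reaches \<eta> n (\<gamma> k)"
proof (induction n arbitrary: k)
  case (Suc n)
  obtain d where d: "d \<in> {(1, 0), (0, 1)}" "\<gamma> (Suc k) = \<gamma> k + d"
    using assms[of k] by (auto simp: oriented_edges_iff)
  show ?case
    unfolding reaches.simps using assms[of k] d Suc[of "Suc k"] by metis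
qed simp

lemma infinite_open_path_iff_reaches:
  "infinite_open_path_from_origin \<eta> \<longleftrightarrow> (\<forall>n. reaches \<eta> n (0, 0))"
proof
  assume "infinite_open_path_from_origin \<eta>"
  then obtain \<gamma> :: "nat \<Rightarrow> vertex" where "\<gamma> 0 = (0, 0)"
    "\<And>k. (\<gamma> k, \<gamma> (Suc k)) \<in> oriented_edges \<and> \<eta> (\<gamma> k, \<gamma> (Suc k))"
    unfolding infinite_open_path_from_origin_def by blast
  then show "\<forall>n. reaches \<eta> n (0, 0)"
    by (metis reaches_if_path)
next
  assume *: "\<forall>n. reaches \<eta> n (0, 0)"
  define Q where "Q v \<longleftrightarrow> (\<forall>n. reaches \<eta> n v)" for v
  have "\<exists>\<gamma>. \<gamma> 0 = (0, 0) \<and>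
      (\<forall>k. Q (\<gamma> k) \<and> (\<gamma> k, \<gamma> (Suc k)) \<in> oriented_edges \<and> \<eta> (\<gamma> k, \<gamma> (Suc k)))"
  proof -
    have step: "\<exists>w. Q w \<and> ((v, w) \<in> oriented_edges \<and> \<eta> (v, w))" if Qv: "Q v" for v
    proof -
      obtain d where "d \<in> {(1, 0), (0, 1)}" "\<eta> (v, v + d)" "\<And>n. reaches \<eta> n (v + d)"
        by (rule reaches_forever_step[of \<eta> v]) (use Qv in \<open>auto simp: Q_def\<close>)
      then show ?thesis unfolding Q_def oriented_edges_iff by blast
    qed
    show ?thesis
      using dependent_nat_choice[where P = "\<lambda>n v. Q v \<and> (n = 0 \<longrightarrow> v = (0, 0))"
          and Q = "\<lambda>n v w. (v, w) \<in> oriented_edges \<and> \<eta> (v, w)"] step * Q_def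
      by (metis nat.distinct(1))
  qed
  then show "infinite_open_path_from_origin \<eta>"
    unfolding infinite_open_path_from_origin_def by blast
qed

text \<open>
  An oriented path of length \<open>n\<close> cannot leave the square of side \<open>n\<close> with lower left corner \<open>v\<close>.
\<close>

lemma reaches_cong:
  assumes "\<And>u w. (u, w) \<in> oriented_edges \<Longrightarrow> fst v \<le> fst u \<Longrightarrow> snd v \<le> snd u \<Longrightarrow>
      fst w \<le> fst v + int n \<Longrightarrow> snd w \<le> snd v + int n \<Longrightarrow> \<eta> (u, w) = \<eta>' (u, w)"
  shows "reaches \<eta> n v = reaches \<eta>' n v"
  using assms
proof (induction n arbitrary: v)
  case (Suc n)
  have "(\<eta> (v, v + d) \<and> reaches \<eta> n (v + d)) = (\<eta>' (v, v + d) \<and> reaches \<eta>' n (v + d))"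
    if d: "d \<in> {(1, 0), (0, 1)}" for d
  proof -
    have "\<eta> (v, v + d) = \<eta>' (v, v + d)"
      by (rule Suc.prems) (use d in \<open>auto simp: oriented_edges_def\<close>)
    moreover have "reaches \<eta> n (v + d) = reaches \<eta>' n (v + d)"
    proof (rule Suc.IH, rule Suc.prems)
      fix u w
      assume "fst (v + d) \<le> fst u" "snd (v + d) \<le> snd u"
        "fst w \<le> fst (v + d) + int n" "snd w \<le> snd (v + d) + int n"
      with d show "fst v \<le> fst u" "snd v \<le> snd u"
        "fst w \<le> fst v + int (Suc n)" "snd w \<le> snd v + int (Suc n)"
        by auto
    qed
    ultimately show ?thesis by simp
  qed
  then show ?case unfolding reaches.simps by (intro bex_cong refl) auto
qed simp

lemma measurable_reaches:
  assumes "\<And>e. e \<in> oriented_edges \<Longrightarrow> Measurable.pred N (\<lambda>\<omega>. \<eta> \<omega> e)"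
  shows "Measurable.pred N (\<lambda>\<omega>. reaches (\<eta> \<omega>) n v)"
proof (induction n arbitrary: v)
  case (Suc n)
  have [measurable]: "Measurable.pred N (\<lambda>\<omega>. \<eta> \<omega> (v, v + d))" if "d \<in> {(1, 0), (0, 1)}" for d
    by (rule assms) (use that in \<open>auto simp: oriented_edges_iff\<close>)
  note [measurable] = Suc
  show ?case unfolding reaches.simps by (intro pred_intros_finite) auto
qed simp


section \<open>Views of the lattice\<close>

text \<open>
  For \<open>s = 1\<close> this is the translation by \<open>x\<close>, for \<open>s = -1\<close> the point reflection that takes the
  origin to \<open>x\<close>. In the second case an oriented path from the origin describes an up-right path in
  the lattice that ends in \<open>x\<close>, traversed backwards. Forward and backward paths can so be treated as
  instances of the same oriented percolation.
\<close>

definition embed :: "vertex \<Rightarrow> int \<Rightarrow> vertex \<Rightarrow> vertex" where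
  "embed x s v = (fst x + s * fst v, snd x + s * snd v)"

definition oriented_view ::
    "(vertex set \<Rightarrow> bool) \<Rightarrow> vertex \<Rightarrow> int \<Rightarrow> vertex \<times> vertex \<Rightarrow> bool" where
  "oriented_view \<sigma> x s = (\<lambda>(u, v). \<sigma> {embed x s u, embed x s v})"

text \<open>
  The vertex \<open>x\<close> is the midpoint of an open up-right path with \<open>2 * n\<close> edges.
\<close>

definition two_sided :: "(vertex set \<Rightarrow> bool) \<Rightarrow> nat \<Rightarrow> vertex \<Rightarrow> bool" where
  "two_sided \<sigma> n x \<longleftrightarrow>
     reaches (oriented_view \<sigma> x 1) n (0, 0) \<and> reaches (oriented_view \<sigma> x (-1)) n (0, 0)"

lemma two_sided_antimono: "m \<le> n \<Longrightarrow> two_sided \<sigma> n x \<Longrightarrow> two_sided \<sigma> m x"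
  unfolding two_sided_def by (auto intro: reaches_antimono)

definition vertex_box :: "nat \<Rightarrow> vertex set" where
  "vertex_box N = {- int N..int N} \<times> {- int N..int N}"

definition box_edges :: "vertex \<Rightarrow> nat \<Rightarrow> vertex set set" where
  "box_edges x n =
     {e \<in> lattice_edges. \<forall>v\<in>e. \<bar>fst v - fst x\<bar> \<le> int n \<and> \<bar>snd v - snd x\<bar> \<le> int n}"

definition quadrant_edges :: "vertex \<Rightarrow> int \<Rightarrow> vertex set set" where
  "quadrant_edges x s =
     {e \<in> lattice_edges. \<forall>v\<in>e. 0 \<le> s * (fst v - fst x) \<and> 0 \<le> s * (snd v - snd x)}"

lemma embed_edge_in_lattice:
  assumes "(u, v) \<in> oriented_edges" "s \<in> {1, -1}"
  shows "{embed x s u, embed x s v} \<in> lattice_edges"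
proof -
  have "neighbour (embed x s u) (embed x s v)"
    using assms by (auto simp: neighbour_def embed_def oriented_edges_def)
  then show ?thesis unfolding lattice_edges_def by blast
qed

text \<open>
  Forgetting the orientation identifies no two oriented edges, because neither \<open>(-1, 0)\<close> nor
  \<open>(0, -1)\<close> is an admissible step. Independence thus passes to the view.
\<close>

lemma inj_on_embed_edge:
  assumes "s \<in> {1, -1}"
  shows "inj_on (\<lambda>(u, v). {embed x s u, embed x s v}) oriented_edges"
  using assms
  by (auto simp: inj_on_def embed_def oriented_edges_def doubleton_eq_iff)

lemma reaches_restrict:
  assumes "s \<in> {1, -1}" "box_edges x n \<inter> quadrant_edges x s \<subseteq> S"
  shows "reaches (oriented_view (restrict \<sigma> S) x s) n (0, 0)
       \<longleftrightarrow> reaches (oriented_view \<sigma> x s) n (0, 0)"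
proof (rule reaches_cong)
  fix u w :: vertex
  assume e: "(u, w) \<in> oriented_edges" and
    *: "fst (0, 0) \<le> fst u" "snd (0, 0) \<le> snd u"
       "fst w \<le> fst (0, 0) + int n" "snd w \<le> snd (0, 0) + int n"
  have "{embed x s u, embed x s w} \<in> box_edges x n \<inter> quadrant_edges x s"
    using embed_edge_in_lattice[OF e assms(1)] * e assms(1)
    by (auto simp: box_edges_def quadrant_edges_def embed_def oriented_edges_def)
  with assms(2) show "oriented_view (restrict \<sigma> S) x s (u, w) = oriented_view \<sigma> x s (u, w)"
    by (auto simp: oriented_view_def)
qed

lemma two_sided_restrict:
  assumes "box_edges x n \<subseteq> S"
  shows "two_sided (restrict \<sigma> S) n x \<longleftrightarrow> two_sided \<sigma> n x"
  unfolding two_sided_def using assms by (subst (1 2) reaches_restrict) auto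

text \<open>
  The two closed quadrants have only the vertex \<open>x\<close> in common, and an edge has two end points.
\<close>

lemma quadrant_edges_disjoint: "quadrant_edges x 1 \<inter> quadrant_edges x (-1) = {}"
proof -
  have False if e: "e \<in> quadrant_edges x 1" "e \<in> quadrant_edges x (-1)" for e
  proof -
    obtain u v where uv: "e = {u, v}" "neighbour u v"
      using e(1) unfolding quadrant_edges_def lattice_edges_def by blast
    then have "u = x" "v = x"
      using e by (auto simp: quadrant_edges_def prod_eq_iff)
    with uv show False by (simp add: neighbour_def)
  qed
  then show ?thesis by blast
qed

lemma box_edges_disjoint:
  assumes "fst x + int m < fst y - int n"
  shows "box_edges x m \<inter> box_edges y n = {}"
proof -
  have False if e: "e \<in> box_edges x m" "e \<in> box_edges y n" for e
  proof -
    obtain v where "v \<in> e"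
      using e(1) unfolding box_edges_def lattice_edges_def by blast
    then have "\<bar>fst v - fst x\<bar> \<le> int m" "\<bar>fst v - fst y\<bar> \<le> int n"
      using e by (auto simp: box_edges_def)
    with assms show False by linarith
  qed
  then show ?thesis by blast
qed

text \<open>
  Coordinates outside \<open>S\<close> are measurable too: there the elements of the product space have the
  default value \<open>undefined\<close>.
\<close>

lemma measurable_PiM_coordinate:
  "(\<lambda>\<sigma>. \<sigma> e) \<in> measurable (PiM S (\<lambda>_. count_space UNIV)) (count_space UNIV)"
proof (cases "e \<in> S")
  case False
  then show ?thesis
    by (subst measurable_cong[where g = "\<lambda>_. undefined"])
      (auto simp: space_PiM PiE_def extensional_def)
qed (rule measurable_component_singleton)

lemma measurable_reaches_view:
  "Measurable.pred (PiM S (\<lambda>_. count_space UNIV)) (\<lambda>\<sigma>. reaches (oriented_view \<sigma> x s) n v)"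
  by (rule measurable_reaches) (auto simp: oriented_view_def intro: measurable_PiM_coordinate)

lemma measurable_two_sided:
  "Measurable.pred (PiM S (\<lambda>_. count_space UNIV)) (\<lambda>\<sigma>. two_sided \<sigma> n x)"
  unfolding two_sided_def by (intro pred_intros_logic measurable_reaches_view)


section \<open>Independent open edges\<close>

text \<open>
  Injectivity makes the singletons \<open>{f j}\<close> disjoint, so that this is a case of grouping independent
  variables into disjoint blocks.
\<close>

lemma (in prob_space) indep_vars_reindex_inj:
  assumes "indep_vars N X I" "inj_on f J" "f ` J \<subseteq> I"
  shows "indep_vars (\<lambda>j. N (f j)) (\<lambda>j. X (f j)) J"
proof -
  have "indep_vars (\<lambda>j. PiM {f j} N) (\<lambda>j \<omega>. restrict (\<lambda>i. X i \<omega>) {f j}) J"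
    using assms by (intro indep_vars_restrict) (auto simp: disjoint_family_on_def inj_on_def)
  then have "indep_vars (\<lambda>j. N (f j)) (\<lambda>j \<omega>. (restrict (\<lambda>i. X i \<omega>) {f j}) (f j)) J"
    by (rule indep_vars_compose2) (rule measurable_component_singleton, simp)
  then show ?thesis by simp
qed

text \<open>
  Bond percolation on the unoriented lattice: \<open>X e\<close> says that the edge \<open>e\<close> is open.
\<close>

locale bernoulli_edges = prob_space M
  for M :: "'w measure" and X :: "vertex set \<Rightarrow> 'w \<Rightarrow> bool" and p :: real +
  assumes indep: "indep_vars (\<lambda>_. count_space UNIV) X lattice_edges"
    and prob_open: "e \<in> lattice_edges \<Longrightarrow> prob {\<omega> \<in> space M. X e \<omega>} = p"
begin

lemma random_variable_edge: "e \<in> lattice_edges \<Longrightarrow> X e \<in> measurable M (count_space UNIV)"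
  using indep by (auto simp: indep_vars_def)

lemma p_bounds: "0 \<le> p" "p \<le> 1"
proof -
  have "{(0, 0), (1, 0)} \<in> lattice_edges"
    unfolding lattice_edges_def neighbour_def by force
  from prob_open[OF this] show "0 \<le> p" "p \<le> 1"
    using measure_nonneg prob_le_1 by metis+
qed

lemma prob_disjoint_regions:
  assumes "S \<inter> T = {}" "S \<subseteq> lattice_edges" "T \<subseteq> lattice_edges"
    and P: "Measurable.pred (PiM S (\<lambda>_. count_space UNIV)) P"
    and Q: "Measurable.pred (PiM T (\<lambda>_. count_space UNIV)) Q"
    and "\<And>\<sigma>. P (restrict \<sigma> S) = P \<sigma>" "\<And>\<sigma>. Q (restrict \<sigma> T) = Q \<sigma>"
  shows "prob {\<omega> \<in> space M. P (\<lambda>e. X e \<omega>) \<and> Q (\<lambda>e. X e \<omega>)} =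
    prob {\<omega> \<in> space M. P (\<lambda>e. X e \<omega>)} * prob {\<omega> \<in> space M. Q (\<lambda>e. X e \<omega>)}"
proof -
  let ?N = "\<lambda>S. PiM S (\<lambda>_. count_space UNIV) :: (vertex set \<Rightarrow> bool) measure"
  let ?R = "\<lambda>S \<omega>. restrict (\<lambda>e. X e \<omega>) S"
  have space: "?R S \<omega> \<in> space (?N S)" for S \<omega>
    by (simp add: space_PiM)
  have "indep_var (?N S) (?R S) (?N T) (?R T)"
    by (rule indep_var_restrict[OF indep]) fact+
  from indep_varD[OF this predE[OF P] predE[OF Q]]
  have "prob ((\<lambda>\<omega>. (?R S \<omega>, ?R T \<omega>)) -` ({\<sigma> \<in> space (?N S). P \<sigma>} \<times> {\<sigma> \<in> space (?N T). Q \<sigma>})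
        \<inter> space M) =
      prob (?R S -` {\<sigma> \<in> space (?N S). P \<sigma>} \<inter> space M) *
      prob (?R T -` {\<sigma> \<in> space (?N T). Q \<sigma>} \<inter> space M)" .
  also have "(\<lambda>\<omega>. (?R S \<omega>, ?R T \<omega>)) -` ({\<sigma> \<in> space (?N S). P \<sigma>} \<times> {\<sigma> \<in> space (?N T). Q \<sigma>})
        \<inter> space M = {\<omega> \<in> space M. P (\<lambda>e. X e \<omega>) \<and> Q (\<lambda>e. X e \<omega>)}"
    using space assms(6,7) by auto
  also have "?R S -` {\<sigma> \<in> space (?N S). P \<sigma>} \<inter> space M = {\<omega> \<in> space M. P (\<lambda>e. X e \<omega>)}"
    using space assms(6) by auto
  also have "?R T -` {\<sigma> \<in> space (?N T). Q \<sigma>} \<inter> space M = {\<omega> \<in> space M. Q (\<lambda>e. X e \<omega>)}"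
    using space assms(7) by auto
  finally show ?thesis .
qed

lemma pred_restrict:
  assumes P: "Measurable.pred (PiM S (\<lambda>_. count_space UNIV)) P"
    and "S \<subseteq> lattice_edges" "\<And>\<sigma>. P (restrict \<sigma> S) = P \<sigma>"
  shows "Measurable.pred M (\<lambda>\<omega>. P (\<lambda>e. X e \<omega>))"
proof -
  have "(\<lambda>\<omega>. restrict (\<lambda>e. X e \<omega>) S) \<in> measurable M (PiM S (\<lambda>_. count_space UNIV))"
    using assms(2) by (intro measurable_restrict random_variable_edge) auto
  from measurable_compose[OF this P] show ?thesis
    by (simp add: assms(3))
qed

lemma distr_edge:
  assumes "e \<in> lattice_edges"
  shows "distr M (count_space UNIV) (X e) = measure_pmf (bernoulli_pmf p)"
proof (rule measure_eqI_finite[where A = UNIV])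
  note X [measurable] = random_variable_edge[OF assms]
  have open_: "prob (X e -` {True} \<inter> space M) = p"
    using prob_open[OF assms] by (simp add: vimage_def Int_def conj_commute)
  have "prob (X e -` {False} \<inter> space M) = prob (space M - {\<omega> \<in> space M. X e \<omega>})"
    by (rule arg_cong[where f = prob]) auto
  also have "\<dots> = 1 - p"
    using prob_open[OF assms] by (subst prob_compl) auto
  finally have closed_: "prob (X e -` {False} \<inter> space M) = 1 - p" .
  fix b :: bool
  show "emeasure (distr M (count_space UNIV) (X e)) {b} = emeasure (measure_pmf (bernoulli_pmf p)) {b}"
    using open_ closed_ p_bounds
    by (cases b) (simp_all add: emeasure_distr emeasure_eq_measure emeasure_pmf_single)
qed auto

lemma distr_oriented_view:
  assumes s: "s \<in> {1, -1}"
  shows "distr M (PiM oriented_edges (\<lambda>_. count_space UNIV))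
      (\<lambda>\<omega>. restrict (oriented_view (\<lambda>e. X e \<omega>) x s) oriented_edges) = oriented_percolation p"
proof -
  define f where "f = (\<lambda>(u, v). {embed x s u, embed x s v})"
  have f: "f ` oriented_edges \<subseteq> lattice_edges"
    using embed_edge_in_lattice[OF _ s] unfolding f_def by (intro image_subsetI) fast
  have "indep_vars (\<lambda>_. count_space UNIV) (\<lambda>j. X (f j)) oriented_edges"
    using indep_vars_reindex_inj[OF indep _ f] inj_on_embed_edge[OF s, of x] unfolding f_def by blast
  moreover have "((0, 0), (1, 0)) \<in> oriented_edges" by (auto simp: oriented_edges_def)
  then have "oriented_edges \<noteq> {}" by blast
  ultimately have "distr M (PiM oriented_edges (\<lambda>_. count_space UNIV)) (\<lambda>\<omega>. \<lambda>i\<in>oriented_edges. X (f i) \<omega>)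
      = PiM oriented_edges (\<lambda>i. distr M (count_space UNIV) (X (f i)))"
    using f by (subst (asm) indep_vars_iff_distr_eq_PiM') (auto intro: random_variable_edge)
  also have "\<dots> = oriented_percolation p"
    unfolding oriented_percolation_def using f by (intro PiM_cong refl distr_edge) auto
  also have "(\<lambda>\<omega>. \<lambda>i\<in>oriented_edges. X (f i) \<omega>) =
      (\<lambda>\<omega>. restrict (oriented_view (\<lambda>e. X e \<omega>) x s) oriented_edges)"
    by (auto simp: f_def oriented_view_def restrict_def)
  finally show ?thesis .
qed

abbreviation survival :: "nat \<Rightarrow> real" where
  "survival n \<equiv>
     measure (oriented_percolation p) {\<eta> \<in> space (oriented_percolation p). reaches \<eta> n (0, 0)}"

lemma sets_oriented_percolation:
  "sets (oriented_percolation p) = sets (PiM oriented_edges (\<lambda>_. count_space UNIV))"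
  unfolding oriented_percolation_def by (rule sets_PiM_cong) auto

lemma pred_reaches_oriented_percolation:
  "Measurable.pred (oriented_percolation p) (\<lambda>\<eta>. reaches \<eta> n v)"
proof (rule measurable_reaches)
  fix e :: "vertex \<times> vertex" assume "e \<in> oriented_edges"
  then show "Measurable.pred (oriented_percolation p) (\<lambda>\<eta>. \<eta> e)"
    unfolding measurable_cong_sets[OF sets_oriented_percolation refl]
    by (rule measurable_component_singleton)
qed

lemma survival_tendsto: "survival \<longlonglongrightarrow> percolation_probability p"
proof -
  let ?O = "oriented_percolation p"
  interpret O: prob_space ?O
    unfolding oriented_percolation_def by (intro prob_space_PiM measure_pmf.prob_space_axioms)
  have "survival \<longlonglongrightarrow> measure ?O (\<Inter>n. {\<eta> \<in> space ?O. reaches \<eta> n (0, 0)})"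
    by (rule O.finite_Lim_measure_decseq)
      (auto simp: decseq_def intro: reaches_antimono predE[OF pred_reaches_oriented_percolation])
  also have "(\<Inter>n. {\<eta> \<in> space ?O. reaches \<eta> n (0, 0)}) =
      {\<eta> \<in> space ?O. infinite_open_path_from_origin \<eta>}"
    by (auto simp: infinite_open_path_iff_reaches)
  finally show ?thesis unfolding percolation_probability_def .
qed

lemma prob_reaches:
  assumes s: "s \<in> {1, -1}"
  shows "prob {\<omega> \<in> space M. reaches (oriented_view (\<lambda>e. X e \<omega>) x s) n (0, 0)} = survival n"
proof -
  let ?N = "PiM oriented_edges (\<lambda>_. count_space UNIV) :: (vertex \<times> vertex \<Rightarrow> bool) measure"
  let ?f = "\<lambda>\<omega>. restrict (oriented_view (\<lambda>e. X e \<omega>) x s) oriented_edges"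
  have f: "?f \<in> measurable M ?N"
  proof (rule measurable_restrict)
    fix e :: "vertex \<times> vertex" assume "e \<in> oriented_edges"
    then show "(\<lambda>\<omega>. oriented_view (\<lambda>e. X e \<omega>) x s e) \<in> measurable M (count_space UNIV)"
      using random_variable_edge[OF embed_edge_in_lattice[OF _ s]]
      by (cases e) (simp add: oriented_view_def)
  qed
  have "survival n = measure (distr M ?N ?f) {\<eta> \<in> space (distr M ?N ?f). reaches \<eta> n (0, 0)}"
    by (simp only: distr_oriented_view[OF s])
  also have "\<dots> = prob (?f -` {\<eta> \<in> space ?N. reaches \<eta> n (0, 0)} \<inter> space M)"
    using predE[OF pred_reaches_oriented_percolation[of n "(0, 0)"]] sets_oriented_percolation
      sets_eq_imp_space_eq[OF sets_oriented_percolation]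
    by (subst measure_distr[OF f]) simp_all
  also have "?f -` {\<eta> \<in> space ?N. reaches \<eta> n (0, 0)} \<inter> space M =
      {\<omega> \<in> space M. reaches (oriented_view (\<lambda>e. X e \<omega>) x s) n (0, 0)}"
  proof -
    have "reaches (restrict \<eta> oriented_edges) n (0, 0) = reaches \<eta> n (0, 0)" for \<eta>
      by (rule reaches_cong) simp
    then show ?thesis by (auto simp: space_PiM)
  qed
  finally show ?thesis ..
qed

lemma prob_two_sided:
  "prob {\<omega> \<in> space M. two_sided (\<lambda>e. X e \<omega>) n x} = (survival n)\<^sup>2"
proof -
  let ?r = "\<lambda>s \<omega>. reaches (oriented_view (\<lambda>e. X e \<omega>) x s) n (0, 0)"
  have "prob {\<omega> \<in> space M. ?r 1 \<omega> \<and> ?r (-1) \<omega>} =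
      prob {\<omega> \<in> space M. ?r 1 \<omega>} * prob {\<omega> \<in> space M. ?r (-1) \<omega>}"
    using quadrant_edges_disjoint
    by (intro prob_disjoint_regions[where S = "quadrant_edges x 1" and T = "quadrant_edges x (-1)"]
        measurable_reaches_view reaches_restrict) (auto simp: quadrant_edges_def)
  then show ?thesis
    by (simp add: two_sided_def prob_reaches power2_eq_square)
qed

lemma pred_two_sided [measurable]: "Measurable.pred M (\<lambda>\<omega>. two_sided (\<lambda>e. X e \<omega>) n x)"
  by (rule pred_restrict[OF measurable_two_sided[where S = "box_edges x n"]])
    (auto simp: two_sided_restrict box_edges_def)

lemma prob_two_sided_forever:
  "prob {\<omega> \<in> space M. \<forall>n. two_sided (\<lambda>e. X e \<omega>) n x} = (percolation_probability p)\<^sup>2"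
proof -
  have "(\<lambda>n. prob {\<omega> \<in> space M. two_sided (\<lambda>e. X e \<omega>) n x}) \<longlonglongrightarrow>
      prob (\<Inter>n. {\<omega> \<in> space M. two_sided (\<lambda>e. X e \<omega>) n x})"
    by (rule finite_Lim_measure_decseq) (auto simp: decseq_def intro: two_sided_antimono)
  moreover have "(\<Inter>n. {\<omega> \<in> space M. two_sided (\<lambda>e. X e \<omega>) n x}) =
      {\<omega> \<in> space M. \<forall>n. two_sided (\<lambda>e. X e \<omega>) n x}"
    by auto
  ultimately show ?thesis
    using LIMSEQ_unique[OF _ tendsto_power[OF survival_tendsto]] unfolding prob_two_sided by auto
qed

text \<open>
  Let \<open>U N\<close> be the event that some vertex of the box of radius \<open>N\<close> lies on an open bi-infinite
  path, and \<open>C N n\<close> the weaker event that some vertex of this box is the midpoint of a path of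
  length \<open>2 * n\<close>. The latter depends on finitely many edges, hence is independent of the event \<open>B\<close>
  that a far vertex \<open>y\<close> is the midpoint of a path of length \<open>2 * m\<close>. If \<open>C N n\<close> fails and \<open>B\<close>
  occurs, then either \<open>y\<close> lies on a bi-infinite path, so that \<open>E\<close> occurs without \<open>U N\<close>, or the path through
  \<open>y\<close> does not extend to a bi-infinite one. This bounds \<open>P(not C N n) P(B)\<close>. The limits in \<open>m\<close>, then
  \<open>n\<close>, then \<open>N\<close> turn the bound into \<open>P(not E) \<theta>\<^sup>2 \<le> 0\<close>.
\<close>

lemma AE_two_sided_forever:
  assumes pos: "percolation_probability p > 0"
  shows "AE \<omega> in M. \<exists>x. \<forall>n. two_sided (\<lambda>e. X e \<omega>) n x"
proof -
  let ?T = "\<lambda>n x \<omega>. two_sided (\<lambda>e. X e \<omega>) n x"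
  let ?\<theta> = "percolation_probability p"
  define E where "E = {\<omega> \<in> space M. \<exists>x. \<forall>n. ?T n x \<omega>}"
  define U where "U N = {\<omega> \<in> space M. \<exists>x\<in>vertex_box N. \<forall>n. ?T n x \<omega>}" for N
  define C where "C N n = {\<omega> \<in> space M. \<exists>x\<in>vertex_box N. ?T n x \<omega>}" for N n
  have sets [measurable]: "E \<in> events" "U N \<in> events" "C N n \<in> events" for N n
    unfolding E_def U_def C_def by measurable
  have finite_box: "finite (vertex_box N)" for N by (simp add: vertex_box_def)

  have far: "prob (space M - C N n) * (survival m)\<^sup>2 \<le> prob (E - U N) + ((survival m)\<^sup>2 - ?\<theta>\<^sup>2)"
    for N n m
  proof -
    \<comment> \<open>the first coordinate puts the square of radius \<open>m\<close> around \<open>y\<close> to the right of \<open>S\<close>\<close>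
    define y :: vertex where "y = (int N + int n + int m + 1, 0)"
    define S where "S = box_edges (0, 0) (N + n)"
    let ?B = "{\<omega> \<in> space M. ?T m y \<omega>}"
    let ?A = "{\<omega> \<in> space M. \<forall>k. ?T k y \<omega>}"
    have local: "(\<exists>x\<in>vertex_box N. two_sided (restrict \<sigma> S) n x) =
        (\<exists>x\<in>vertex_box N. two_sided \<sigma> n x)" for \<sigma>
    proof (rule bex_cong[OF refl])
      fix x assume "x \<in> vertex_box N"
      then have "box_edges x n \<subseteq> S"
        unfolding S_def box_edges_def vertex_box_def by fastforce
      then show "two_sided (restrict \<sigma> S) n x = two_sided \<sigma> n x" by (rule two_sided_restrict)
    qed
    have subset_lattice: "S \<subseteq> lattice_edges" "box_edges y m \<subseteq> lattice_edges"
      by (auto simp: S_def box_edges_def)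
    have "S \<inter> box_edges y m = {}"
      unfolding S_def by (rule box_edges_disjoint) (simp add: y_def)
    then have "prob {\<omega> \<in> space M. \<not> (\<exists>x\<in>vertex_box N. ?T n x \<omega>) \<and> ?T m y \<omega>} =
        prob {\<omega> \<in> space M. \<not> (\<exists>x\<in>vertex_box N. ?T n x \<omega>)} * prob ?B"
      using subset_lattice two_sided_restrict[of y m "box_edges y m"]
      by (intro prob_disjoint_regions[where S = S and T = "box_edges y m"] measurable_two_sided
          pred_intros_finite finite_box pred_intros_logic) (simp_all only: local subset_refl)
    moreover have "{\<omega> \<in> space M. \<not> (\<exists>x\<in>vertex_box N. ?T n x \<omega>)} = space M - C N n"
      by (auto simp: C_def)
    ultimately have "prob (space M - C N n) * (survival m)\<^sup>2 =
        prob {\<omega> \<in> space M. \<not> (\<exists>x\<in>vertex_box N. ?T n x \<omega>) \<and> ?T m y \<omega>}"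
      by (simp add: prob_two_sided)
    also have "\<dots> \<le> prob ((E - U N) \<union> (?B - ?A))"
      by (rule finite_measure_mono) (auto simp: E_def U_def C_def simp del: split_paired_Ex)
    also have "\<dots> \<le> prob (E - U N) + prob (?B - ?A)"
      by (rule measure_Un_le) auto
    also have "prob (?B - ?A) = prob ?B - prob ?A"
      by (rule finite_measure_Diff) auto
    finally show ?thesis
      by (simp add: prob_two_sided prob_two_sided_forever)
  qed

  have bound_C: "prob (space M - C N n) * ?\<theta>\<^sup>2 \<le> prob (E - U N)" for N n
  proof -
    have "(\<lambda>m. prob (space M - C N n) * (survival m)\<^sup>2) \<longlonglongrightarrow> prob (space M - C N n) * ?\<theta>\<^sup>2"
      by (intro tendsto_intros survival_tendsto)
    moreover have "(\<lambda>m. prob (E - U N) + ((survival m)\<^sup>2 - ?\<theta>\<^sup>2)) \<longlonglongrightarrow>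
        prob (E - U N) + (?\<theta>\<^sup>2 - ?\<theta>\<^sup>2)"
      by (intro tendsto_intros survival_tendsto)
    ultimately show ?thesis
      using far by (auto dest: LIMSEQ_le)
  qed
  have lim_C: "(\<lambda>n. prob (space M - C N n)) \<longlonglongrightarrow> prob (space M - U N)" for N
  proof -
    have "(\<lambda>n. prob (space M - C N n)) \<longlonglongrightarrow> prob (\<Union>n. space M - C N n)"
      by (rule finite_Lim_measure_incseq)
        (auto simp: incseq_def C_def dest: two_sided_antimono)
    also have "(\<Union>n. space M - C N n) = space M - U N"
    proof -
      \<comment> \<open>the box is finite, so failing lengths of its vertices have a common upper bound\<close>
      have "\<exists>x\<in>vertex_box N. \<forall>n. ?T n x \<omega>" if *: "\<forall>n. \<exists>x\<in>vertex_box N. ?T n x \<omega>" for \<omega>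
      proof (rule ccontr)
        assume "\<not> (\<exists>x\<in>vertex_box N. \<forall>n. ?T n x \<omega>)"
        then obtain k where k: "\<And>x. x \<in> vertex_box N \<Longrightarrow> \<not> ?T (k x) x \<omega>" by metis
        obtain x where x: "x \<in> vertex_box N" "?T (Max (k ` vertex_box N)) x \<omega>"
          using * by blast
        moreover have "k x \<le> Max (k ` vertex_box N)"
          using x finite_box by (intro Max_ge) auto
        ultimately show False using k two_sided_antimono by blast
      qed
      then show ?thesis by (auto simp: C_def U_def)
    qed
    finally show ?thesis .
  qed
  have "prob (space M - U N) * ?\<theta>\<^sup>2 \<le> prob (E - U N)" for N
    by (rule LIMSEQ_le_const2[OF tendsto_mult_right[OF lim_C]]) (use bound_C in blast)
  moreover have "prob (space M - E) \<le> prob (space M - U N)" for N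
    by (rule finite_measure_mono) (auto simp: E_def U_def)
  ultimately have bound: "prob (space M - E) * ?\<theta>\<^sup>2 \<le> prob (E - U N)" for N
    by (meson mult_right_mono order_trans zero_le_power2)
  have "(\<lambda>N. prob (E - U N)) \<longlonglongrightarrow> prob (\<Inter>N. E - U N)"
    by (rule finite_Lim_measure_decseq) (fastforce simp: decseq_def U_def vertex_box_def)+
  also have "(\<Inter>N. E - U N) = {}"
  proof -
    have "x \<in> vertex_box (nat (\<bar>fst x\<bar> + \<bar>snd x\<bar>))" for x
      by (cases x) (auto simp: vertex_box_def)
    then show ?thesis by (auto simp: E_def U_def)
  qed
  finally have "prob (space M - E) * ?\<theta>\<^sup>2 \<le> 0"
    using bound by (auto intro: LIMSEQ_le_const)
  then have "prob (space M - E) = 0"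
    using pos by (simp add: mult_le_0_iff measure_le_0_iff)
  then show ?thesis
    by (intro AE_I'[of "space M - E"]) (auto simp: null_sets_def emeasure_eq_measure E_def)
qed

end


section \<open>Oriented open paths are geodesics\<close>

text \<open>
  The forward path from \<open>x\<close> and the reversed backward path from \<open>x\<close> are glued at \<open>x\<close>.
\<close>

lemma bi_infinite_open_path:
  assumes "\<forall>n. two_sided \<sigma> n x"
  obtains \<gamma> :: "int \<Rightarrow> vertex"
    where "\<And>i. (\<gamma> i, \<gamma> (i + 1)) \<in> oriented_edges" "\<And>i. \<sigma> {\<gamma> i, \<gamma> (i + 1)}"
proof -
  have "infinite_open_path_from_origin (oriented_view \<sigma> x 1)"
    "infinite_open_path_from_origin (oriented_view \<sigma> x (-1))"
    using assms by (auto simp: infinite_open_path_iff_reaches two_sided_def)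
  then obtain g h :: "nat \<Rightarrow> vertex" where
    g: "g 0 = (0, 0)" "\<And>n. (g n, g (Suc n)) \<in> oriented_edges"
      "\<And>n. oriented_view \<sigma> x 1 (g n, g (Suc n))" and
    h: "h 0 = (0, 0)" "\<And>n. (h n, h (Suc n)) \<in> oriented_edges"
      "\<And>n. oriented_view \<sigma> x (-1) (h n, h (Suc n))"
    unfolding infinite_open_path_from_origin_def by blast
  define \<gamma> where "\<gamma> i = (if 0 \<le> i then embed x 1 (g (nat i)) else embed x (-1) (h (nat (- i))))"
    for i :: int
  have "(\<gamma> i, \<gamma> (i + 1)) \<in> oriented_edges \<and> \<sigma> {\<gamma> i, \<gamma> (i + 1)}" for i
  proof (cases "0 \<le> i")
    case True
    then have "nat (i + 1) = Suc (nat i)" by simp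
    with True g(2,3)[of "nat i"] show ?thesis
      by (auto simp: \<gamma>_def embed_def oriented_edges_def oriented_view_def)
  next
    case False
    define k where "k = nat (- i - 1)"
    have k: "nat (- i) = Suc k" "nat (- (i + 1)) = k"
      using False by (auto simp: k_def)
    have "\<gamma> (i + 1) = embed x (-1) (h k)"
      using False k g(1) h(1) by (cases "i = -1") (auto simp: \<gamma>_def embed_def)
    moreover have "\<gamma> i = embed x (-1) (h (Suc k))"
      using False k by (simp add: \<gamma>_def)
    ultimately show ?thesis
      using h(2,3)[of k]
      by (auto simp: embed_def oriented_edges_def oriented_view_def insert_commute)
  qed
  then show thesis using that by blast
qed

definition l1_distance :: "vertex \<Rightarrow> vertex \<Rightarrow> int" where
  "l1_distance x y = \<bar>fst x - fst y\<bar> + \<bar>snd x - snd y\<bar>"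

lemma path_time_step:
  "m \<le> n \<Longrightarrow> path_time t m (n + 1) \<gamma> = path_time t m n \<gamma> + t {\<gamma> n, \<gamma> (n + 1)}"
proof -
  assume "m \<le> n"
  then have "{m..<n + 1} = insert n {m..<n}" by auto
  then show ?thesis by (simp add: path_time_def)
qed

lemma l1_distance_le_path_time:
  assumes "\<And>e. e \<in> lattice_edges \<Longrightarrow> 1 \<le> t e" and "m \<le> n" and "lattice_path {m..n} \<gamma>"
  shows "l1_distance (\<gamma> m) (\<gamma> n) \<le> path_time t m n \<gamma>"
  using assms(2,3)
proof (induction n rule: int_ge_induct)
  case base
  show ?case by (simp add: l1_distance_def path_time_def)
next
  case (step n)
  have nb: "neighbour (\<gamma> n) (\<gamma> (n + 1))"
    using step.prems step.hyps by (auto simp: lattice_path_def)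
  then have "1 \<le> t {\<gamma> n, \<gamma> (n + 1)}"
    by (intro assms(1)) (unfold lattice_edges_def, blast)
  moreover have "l1_distance (\<gamma> m) (\<gamma> n) \<le> path_time t m n \<gamma>"
    using step.prems by (intro step.IH) (auto simp: lattice_path_def)
  moreover have "l1_distance (\<gamma> m) (\<gamma> (n + 1)) \<le> l1_distance (\<gamma> m) (\<gamma> n) + 1"
    using nb by (simp add: l1_distance_def neighbour_def)
  ultimately show ?case
    using step.hyps by (simp add: path_time_step)
qed

text \<open>
  Along an up-right path the \<open>\<ell>\<^sup>1\<close>-distance to the starting point grows by exactly 1 with every
  edge, at a cost of at most 1. This meets the lower bound \<open>l1_distance_le_path_time\<close>.
\<close>

lemma oriented_path_is_geodesic:
  assumes t: "\<And>e. e \<in> lattice_edges \<Longrightarrow> 1 \<le> t e"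
    and oriented: "\<And>i. (\<gamma> i, \<gamma> (i + 1)) \<in> oriented_edges"
    and cheap: "\<And>i. t {\<gamma> i, \<gamma> (i + 1)} \<le> 1"
  shows "bi_infinite_geodesic t \<gamma>"
proof -
  have path: "lattice_path I \<gamma>" for I
  proof -
    have "neighbour (\<gamma> i) (\<gamma> (i + 1))" for i
      using oriented[of i] by (auto simp: neighbour_def oriented_edges_def)
    then show ?thesis by (simp add: lattice_path_def)
  qed
  have "geodesic t (\<gamma> m) (\<gamma> n) m n \<gamma>" if "m \<le> n" for m n
  proof -
    let ?T = "{path_time t a b \<delta> | a b \<delta>. finite_path_between (\<gamma> m) (\<gamma> n) a b \<delta>}"
    have \<gamma>: "finite_path_between (\<gamma> m) (\<gamma> n) m n \<gamma>"
      using that path by (simp add: finite_path_between_def)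
    have lower: "l1_distance (\<gamma> m) (\<gamma> n) \<le> z" if z: "z \<in> ?T" for z :: real
    proof -
      obtain a b \<delta> where "z = path_time t a b \<delta>" "finite_path_between (\<gamma> m) (\<gamma> n) a b \<delta>"
        using z by blast
      then show ?thesis
        using l1_distance_le_path_time[of t a b \<delta>, OF t] by (auto simp: finite_path_between_def)
    qed
    have "fst (\<gamma> m) \<le> fst (\<gamma> n) \<and> snd (\<gamma> m) \<le> snd (\<gamma> n) \<and>
        path_time t m n \<gamma> \<le> l1_distance (\<gamma> m) (\<gamma> n)"
      using that
    proof (induction n rule: int_ge_induct)
      case base
      show ?case by (simp add: path_time_def l1_distance_def)
    next
      case (step n)
      then show ?case
        using oriented[of n] cheap[of n]
        by (auto simp: path_time_step l1_distance_def oriented_edges_def)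
    qed
    moreover have "path_time t m n \<gamma> \<in> ?T" using \<gamma> by blast
    ultimately have "Inf ?T = path_time t m n \<gamma>"
      using lower by (intro cInf_eq_minimum) (blast intro: order_trans)+
    with \<gamma> show ?thesis by (simp add: geodesic_def first_passage_time_def)
  qed
  with path show ?thesis by (simp add: bi_infinite_geodesic_def)
qed


section \<open>The passage time distribution\<close>

text \<open>
  If \<open>F\<close> were positive at \<open>x\<close>, then the leftmost point of increase \<open>Inf {y. 0 < F y}\<close>, which lies in
  the support, would be at most \<open>x\<close>.
\<close>

lemma cdf_zero_below_Inf_support:
  assumes F: "distribution_function_on_nonneg F" and "x < Inf (cdf_support F)"
  shows "F x = 0"
proof (rule ccontr)
  assume "F x \<noteq> 0"
  have mono: "mono F" and neg: "\<And>x. x < 0 \<Longrightarrow> F x = 0"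
    using F by (auto simp: distribution_function_on_nonneg_def)
  have nonneg: "0 \<le> F y" for y
    using neg[of "min y (-1)"] monoD[OF mono, of "min y (-1)" y] by simp
  define P where "P = {y. 0 < F y}"
  have P: "x \<in> P" "\<And>y. y \<in> P \<Longrightarrow> 0 \<le> y"
  proof -
    show "x \<in> P" using \<open>F x \<noteq> 0\<close> nonneg[of x] by (simp add: P_def)
    show "0 \<le> y" if "y \<in> P" for y
      using neg[of y] that by (cases "y < 0") (simp_all add: P_def)
  qed
  from P(2) have bdd: "bdd_below P" by (rule bdd_belowI)
  have "Inf P \<in> cdf_support F"
    unfolding cdf_support_def
  proof safe
    fix \<epsilon> :: real assume "0 < \<epsilon>"
    then obtain y where "y \<in> P" "y < Inf P + \<epsilon>"
      using P(1) bdd cInf_less_iff[of P "Inf P + \<epsilon>"] by auto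
    then have "0 < F (Inf P + \<epsilon>)"
      using monoD[OF mono, of y "Inf P + \<epsilon>"] by (simp add: P_def)
    moreover have "Inf P - \<epsilon> \<notin> P"
      using cInf_lower[OF _ bdd, of "Inf P - \<epsilon>"] \<open>0 < \<epsilon>\<close> by auto
    ultimately show "0 < F (Inf P + \<epsilon>) - F (Inf P - \<epsilon>)"
      using nonneg[of "Inf P - \<epsilon>"] by (simp add: P_def)
  qed
  moreover have "bdd_below (cdf_support F)"
  proof (rule bdd_belowI[where m = 0])
    fix y assume y: "y \<in> cdf_support F"
    show "0 \<le> y"
    proof (rule ccontr)
      assume "\<not> 0 \<le> y"
      then have "F (y + (- y / 2)) = 0" "F (y - (- y / 2)) = 0" by (auto intro!: neg)
      moreover have "0 < - y / 2" using \<open>\<not> 0 \<le> y\<close> by simp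
      moreover from this have "0 < F (y + (- y / 2)) - F (y - (- y / 2))"
        using y unfolding cdf_support_def by blast
      ultimately show False by simp
    qed
  qed
  ultimately have "Inf (cdf_support F) \<le> Inf P" by (rule cInf_lower)
  also have "Inf P \<le> x" using P(1) bdd by (rule cInf_lower)
  finally show False using assms(2) by simp
qed

lemma percolation_probability_pos:
  assumes "p > oriented_critical_value" "0 \<le> p" "p \<le> 1"
  shows "percolation_probability p > 0"
proof -
  have "bdd_above {p \<in> {0..1}. percolation_probability p = 0}"
    by (rule bdd_aboveI[where M = 1]) auto
  then have "percolation_probability p \<noteq> 0"
    using assms cSup_upper[of p "{p \<in> {0..1}. percolation_probability p = 0}"]
    by (auto simp: oriented_critical_value_def)
  then show ?thesis
    by (simp add: percolation_probability_def zero_less_measure_iff)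
qed

lemma countable_lattice_edges: "countable lattice_edges"
proof -
  have "lattice_edges \<subseteq> (\<lambda>(x, y). {x, y}) ` (UNIV :: (vertex \<times> vertex) set)"
    by (auto simp: lattice_edges_def)
  then show ?thesis by (rule countable_subset) simp
qed

lemma (in prob_space) AE_ge_if_cdf_zero_below:
  assumes X [measurable]: "X \<in> borel_measurable M"
    and zero: "\<And>x. x < c \<Longrightarrow> cdf (distr M borel X) x = 0"
  shows "AE \<omega> in M. c \<le> X \<omega>"
proof -
  have "AE \<omega> in M. \<not> X \<omega> \<le> c - 1 / real (Suc n)" for n
  proof (rule AE_I[OF subset_refl])
    have "prob (X -` {..c - 1 / real (Suc n)} \<inter> space M) = 0"
      using zero[of "c - 1 / real (Suc n)"] by (simp add: cdf_def measure_distr)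
    then show "emeasure M {\<omega> \<in> space M. \<not> \<not> X \<omega> \<le> c - 1 / real (Suc n)} = 0"
      by (simp add: emeasure_eq_measure vimage_def Int_def conj_commute)
  qed measurable
  then have "AE \<omega> in M. \<forall>n. \<not> X \<omega> \<le> c - 1 / real (Suc n)"
    by (simp add: AE_all_countable)
  then show ?thesis
  proof (rule AE_mp, intro AE_I2 impI)
    fix \<omega> assume *: "\<forall>n. \<not> X \<omega> \<le> c - 1 / real (Suc n)"
    show "c \<le> X \<omega>"
    proof (rule ccontr)
      assume "\<not> c \<le> X \<omega>"
      then have "0 < c - X \<omega>" by simp
      then obtain n where "1 / real (Suc n) < c - X \<omega>" by (rule nat_approx_posE)
      with *[rule_format, of n] show False by linarith
    qed
  qed
qed


section \<open>Existence of a bi-infinite geodesic\<close>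

theorem theorem1p7:
  fixes M :: "'w measure"
    and t :: "vertex set \<Rightarrow> 'w \<Rightarrow> real"
    and F :: "real \<Rightarrow> real"
    and p :: real
  assumes "prob_space M"
    and "distribution_function_on_nonneg F"
    and "Inf (cdf_support F) = 1"
    and "F 1 = p"
    and "p > oriented_critical_value"
    and "\<And>e \<omega>. e \<in> lattice_edges \<Longrightarrow> \<omega> \<in> space M \<Longrightarrow> t e \<omega> > 0"
    and "prob_space.indep_vars M (\<lambda>_. borel) t lattice_edges"
    and "\<And>e. e \<in> lattice_edges \<Longrightarrow> cdf (distr M borel (t e)) = F"
  shows "AE \<omega> in M. \<exists>\<gamma>. bi_infinite_geodesic (\<lambda>e. t e \<omega>) \<gamma>"
proof -
  interpret prob_space M by fact
  have t [measurable]: "t e \<in> borel_measurable M" if "e \<in> lattice_edges" for e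
    using assms(7) that by (auto simp: indep_vars_def)
  interpret bernoulli_edges M "\<lambda>e \<omega>. t e \<omega> \<le> 1" p
  proof
    show "indep_vars (\<lambda>_. count_space UNIV) (\<lambda>e \<omega>. t e \<omega> \<le> 1) lattice_edges"
      by (rule indep_vars_compose2[OF assms(7)]) measurable
    fix e assume e: "e \<in> lattice_edges"
    have "p = cdf (distr M borel (t e)) 1"
      using assms(4,8) e by simp
    also have "\<dots> = prob (t e -` {..1} \<inter> space M)"
      using t[OF e] by (simp add: cdf_def measure_distr)
    also have "t e -` {..1} \<inter> space M = {\<omega> \<in> space M. t e \<omega> \<le> 1}" by auto
    finally show "prob {\<omega> \<in> space M. t e \<omega> \<le> 1} = p" ..
  qed
  have "AE \<omega> in M. \<exists>x. \<forall>n. two_sided (\<lambda>e. t e \<omega> \<le> 1) n x"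
    by (intro AE_two_sided_forever percolation_probability_pos assms(5) p_bounds)
  moreover have "AE \<omega> in M. \<forall>e\<in>lattice_edges. 1 \<le> t e \<omega>"
  proof -
    have "AE \<omega> in M. 1 \<le> t e \<omega>" if "e \<in> lattice_edges" for e
      using cdf_zero_below_Inf_support[OF assms(2)] assms(3,8) that
      by (intro AE_ge_if_cdf_zero_below t) auto
    then show ?thesis
      by (simp add: AE_ball_countable[OF countable_lattice_edges])
  qed
  ultimately show ?thesis
  proof eventually_elim
    case (elim \<omega>)
    then obtain x where "\<forall>n. two_sided (\<lambda>e. t e \<omega> \<le> 1) n x" by blast
    then obtain \<gamma> :: "int \<Rightarrow> vertex"
      where "\<And>i. (\<gamma> i, \<gamma> (i + 1)) \<in> oriented_edges" "\<And>i. t {\<gamma> i, \<gamma> (i + 1)} \<omega> \<le> 1"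
      using bi_infinite_open_path[of "\<lambda>e. t e \<omega> \<le> 1" x] by blast
    with elim have "bi_infinite_geodesic (\<lambda>e. t e \<omega>) \<gamma>"
      by (intro oriented_path_is_geodesic) auto
    then show ?case by blast
  qed
qed

end
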